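(* Let $\mathcal{T}=(\mathcal{V},\mathcal{E})$ be a tree with $\mathcal{V}=\{1,\ldots,d\}$, let $r\in\mathcal{V}$ be a chosen root and $\mathcal{T}_r$ the corresponding rooted tree, and let $\boldsymbol{q}=(q_v,\,v\in\mathcal{V})\in(0,1)^d$ and $\boldsymbol{\alpha}=(\alpha_e,\,e\in\mathcal{E})\in\Lambda(\boldsymbol{q})$. For $v\in\mathrm{dsc}(r)$ put $\sigma_{(\mathrm{pa}(v),v)}=\sqrt{q_{\mathrm{pa}(v)}q_v(1-q_{\mathrm{pa}(v)})(1-q_v)}$, $$\beta_{v,0}=q_v-\alpha_{(\mathrm{pa}(v),v)}\frac{\sigma_{(\mathrm{pa}(v),v)}}{1-q_{\mathrm{pa}(v)}},\qquad \beta_{v,1}=q_v+\alpha_{(\mathrm{pa}(v),v)}\frac{\sigma_{(\mathrm{pa}(v),v)}}{q_{\mathrm{pa}(v)}}.$$ Let $J_r\sim\mathrm{Bernoulli}(q_r)$, let $I_{v,i}\sim\mathrm{Bernoulli}(\beta_{v,i})$ for $v\in\mathrm{dsc}(r)$, $i\in\{0,1\}$, all these random variables (including $J_r$) being mutually independent, and define recursively, for $v\in\mathrm{dsc}(r)$, $$J_v=(1-J_{\mathrm{pa}(v)})\,I_{v,0}+J_{\mathrm{pa}(v)}\,I_{v,1}.$$ Then $\boldsymbol{J}=(J_v,\,v\in\mathcal{V})$ is a tree-structured Ising model on $\mathcal{T}$, mean-parameterized by $\boldsymbol{q}$ and $\boldsymbol{\alpha}$.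
   Context: Rooted tree $\mathcal{T}_r$: the descendants $\mathrm{dsc}(u)$ of $u$ are the vertices $j\neq u$ such that $u$ lies on the path from $j$ to the root $r$ (so $\mathrm{dsc}(r)=\mathcal{V}\setminus\{r\}$); the parent $\mathrm{pa}(u)$ of $u\neq r$ is its unique neighbor that is not a descendant of $u$. $\Lambda(\boldsymbol{q})$ is the set of $\boldsymbol{\alpha}=(\alpha_e,e\in\mathcal{E})$ such that, for every edge $(u,v)\in\mathcal{E}$, $$-\min\left(\sqrt{\tfrac{q_uq_v}{(1-q_u)(1-q_v)}},\sqrt{\tfrac{(1-q_u)(1-q_v)}{q_uq_v}}\right)<\alpha_{(u,v)}<\min\left(\sqrt{\tfrac{(1-q_u)q_v}{q_u(1-q_v)}},\sqrt{\tfrac{q_u(1-q_v)}{(1-q_u)q_v}}\right).$$ Tree-structured Ising model mean-parameterized by $\boldsymbol{q},\boldsymbol{\alpha}$ on $\mathcal{T}$: a random vector $\boldsymbol{J}$ on $\{0,1\}^d$ whose pmf has the form $$p_{\boldsymbol{J}}(\boldsymbol{x})=\exp\Big(\sum_{v\in\mathcal{V}}\eta_vx_v+\sum_{(u,v)\in\mathcal{E}}\eta_{(u,v)}x_ux_v-A(\boldsymbol{\eta})\Big),\quad\boldsymbol{x}\in\{0,1\}^d,$$ for some real parameters $\eta_v$ ($v\in\mathcal{V}$), $\eta_e$ ($e\in\mathcal{E}$) and normalizing constant $A(\boldsymbol{\eta})$, with $\mathrm{E}[J_v]=q_v$ for all $v\in\mathcal{V}$ and Pearson correlation $\mathrm{Corr}(J_u,J_v)=\alpha_{(u,v)}$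 for all edges $(u,v)\in\mathcal{E}$. *)

theory Defs
  imports "HOL-Probability.Probability"
begin

text \<open>
  An undirected simple graph is given by a vertex set \<open>V\<close> and a set \<open>E\<close> of two-element
  subsets of \<open>V\<close>; the edge written \<open>(u,v)\<close> or \<open>(v,u)\<close> on paper is the set \<open>{u,v}\<close>.
\<close>

definition simple_graph :: "'v set \<Rightarrow> 'v set set \<Rightarrow> bool" where
  "simple_graph V E \<longleftrightarrow>
     finite V \<and> (\<forall>e\<in>E. \<exists>u\<in>V. \<exists>v\<in>V. u \<noteq> v \<and> e = {u, v})"

definition path_between :: "'v set \<Rightarrow> 'v set set \<Rightarrow> 'v \<Rightarrow> 'v list \<Rightarrow> 'v \<Rightarrow> bool" where
  "path_between V E u p v \<longleftrightarrow>
     p \<noteq> [] \<and> hd p = u \<and> last p = v \<and> set p \<subseteq> V \<and> distinct p \<and>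
     successively (\<lambda>a b. {a, b} \<in> E) p"

definition graph_cycle :: "'v set \<Rightarrow> 'v set set \<Rightarrow> 'v list \<Rightarrow> bool" where
  "graph_cycle V E p \<longleftrightarrow>
     length p \<ge> 3 \<and> set p \<subseteq> V \<and> distinct p \<and>
     successively (\<lambda>a b. {a, b} \<in> E) p \<and> {last p, hd p} \<in> E"

definition tree_graph :: "'v set \<Rightarrow> 'v set set \<Rightarrow> bool" where
  "tree_graph V E \<longleftrightarrow>
     simple_graph V E \<and> V \<noteq> {} \<and>
     (\<forall>u\<in>V. \<forall>v\<in>V. \<exists>p. path_between V E u p v) \<and>
     (\<nexists>p. graph_cycle V E p)"

text \<open>In a tree the path \<open>p\<close> below is the unique path from \<open>j\<close> to the root \<open>r\<close>.\<close>

definition dsc :: "'v set \<Rightarrow> 'v set set \<Rightarrow> 'v \<Rightarrow> 'v \<Rightarrow> 'v set" where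
  "dsc V E r u = {j \<in> V. j \<noteq> u \<and> (\<exists>p. path_between V E j p r \<and> u \<in> set p)}"

definition pa :: "'v set \<Rightarrow> 'v set set \<Rightarrow> 'v \<Rightarrow> 'v \<Rightarrow> 'v" where
  "pa V E r u = (THE w. {w, u} \<in> E \<and> w \<notin> dsc V E r u)"

text \<open>
  Real-valued, so that expectations, correlations and \<open>1 - X\<close> have their usual meaning;
  the values \<open>0\<close> and \<open>1\<close> are attained almost surely.
\<close>

definition bernoulli_rv :: "'w measure \<Rightarrow> real \<Rightarrow> ('w \<Rightarrow> real) \<Rightarrow> bool" where
  "bernoulli_rv M p X \<longleftrightarrow>
     X \<in> borel_measurable M \<and> distr M borel X = distr (bernoulli_pmf p) borel of_bool"

definition correlation :: "'w measure \<Rightarrow> ('w \<Rightarrow> real) \<Rightarrow> ('w \<Rightarrow> real) \<Rightarrow> real" where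
  "correlation M X Y =
     prob_space.expectation M
       (\<lambda>\<omega>. (X \<omega> - prob_space.expectation M X) * (Y \<omega> - prob_space.expectation M Y))
     / sqrt (prob_space.variance M X * prob_space.variance M Y)"

definition ising_energy ::
    "'v set \<Rightarrow> 'v set set \<Rightarrow> ('v \<Rightarrow> real) \<Rightarrow> ('v set \<Rightarrow> real) \<Rightarrow> ('v \<Rightarrow> real) \<Rightarrow> real" where
  "ising_energy V E \<eta>v \<eta>e x = (\<Sum>v\<in>V. \<eta>v v * x v) + (\<Sum>e\<in>E. \<eta>e e * (\<Prod>v\<in>e. x v))"

definition log_partition ::
    "'v set \<Rightarrow> 'v set set \<Rightarrow> ('v \<Rightarrow> real) \<Rightarrow> ('v set \<Rightarrow> real) \<Rightarrow> real" where
  "log_partition V E \<eta>v \<eta>e = ln (\<Sum>x\<in>V \<rightarrow>\<^sub>E {0, 1}. exp (ising_energy V E \<eta>v \<eta>e x))"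

definition tree_ising_model ::
    "'v set \<Rightarrow> 'v set set \<Rightarrow> ('v \<Rightarrow> real) \<Rightarrow> ('v set \<Rightarrow> real) \<Rightarrow>
     'w measure \<Rightarrow> ('v \<Rightarrow> 'w \<Rightarrow> real) \<Rightarrow> bool" where
  "tree_ising_model V E q \<alpha> M J \<longleftrightarrow>
     (\<forall>v\<in>V. J v \<in> borel_measurable M) \<and>
     (AE \<omega> in M. \<forall>v\<in>V. J v \<omega> \<in> {0, 1}) \<and>
     (\<exists>\<eta>v \<eta>e. \<forall>x \<in> V \<rightarrow>\<^sub>E {0, 1}.
        measure M {\<omega> \<in> space M. \<forall>v\<in>V. J v \<omega> = x v}
        = exp (ising_energy V E \<eta>v \<eta>e x - log_partition V E \<eta>v \<eta>e)) \<and>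
     (\<forall>v\<in>V. prob_space.expectation M (J v) = q v) \<and>
     (\<forall>u v. {u, v} \<in> E \<longrightarrow> correlation M (J u) (J v) = \<alpha> {u, v})"

text \<open>The bounds are symmetric in \<open>u\<close> and \<open>v\<close>, so indexing by unordered edges is sound.\<close>

definition Lambda :: "'v set set \<Rightarrow> ('v \<Rightarrow> real) \<Rightarrow> ('v set \<Rightarrow> real) set" where
  "Lambda E q = {\<alpha>. \<forall>u v. {u, v} \<in> E \<longrightarrow>
     - min (sqrt (q u * q v / ((1 - q u) * (1 - q v))))
           (sqrt ((1 - q u) * (1 - q v) / (q u * q v))) < \<alpha> {u, v} \<and>
     \<alpha> {u, v} < min (sqrt ((1 - q u) * q v / (q u * (1 - q v))))
                   (sqrt (q u * (1 - q v) / ((1 - q u) * q v)))}"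

definition edge_sigma :: "('v \<Rightarrow> real) \<Rightarrow> 'v \<Rightarrow> 'v \<Rightarrow> real" where
  "edge_sigma q u v = sqrt (q u * q v * (1 - q u) * (1 - q v))"

definition beta0 ::
    "'v set \<Rightarrow> 'v set set \<Rightarrow> 'v \<Rightarrow> ('v \<Rightarrow> real) \<Rightarrow> ('v set \<Rightarrow> real) \<Rightarrow> 'v \<Rightarrow> real" where
  "beta0 V E r q \<alpha> v =
     (let u = pa V E r v in q v - \<alpha> {u, v} * (edge_sigma q u v / (1 - q u)))"

definition beta1 ::
    "'v set \<Rightarrow> 'v set set \<Rightarrow> 'v \<Rightarrow> ('v \<Rightarrow> real) \<Rightarrow> ('v set \<Rightarrow> real) \<Rightarrow> 'v \<Rightarrow> real" where
  "beta1 V E r q \<alpha> v =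
     (let u = pa V E r v in q v + \<alpha> {u, v} * (edge_sigma q u v / q u))"

text \<open>
  The family \<open>(J\<^sub>r, I\<^sub>v\<^sub>,\<^sub>i)\<close> as a single indexed family:
  \<open>None\<close> indexes the root variable, \<open>Some (v, i)\<close> indexes \<open>I v i\<close>.
\<close>

definition driving_family ::
    "('w \<Rightarrow> real) \<Rightarrow> ('v \<Rightarrow> nat \<Rightarrow> 'w \<Rightarrow> real) \<Rightarrow> ('v \<times> nat) option \<Rightarrow> 'w \<Rightarrow> real" where
  "driving_family X I k = (case k of None \<Rightarrow> X | Some (v, i) \<Rightarrow> I v i)"

end

theory Submission
  imports Defs
begin

text \<open>
  Once the tree is rooted at \<open>r\<close>, every vertex \<open>v \<noteq> r\<close> has one parent, the parent is strictly
  closer to \<open>r\<close>, and every edge joins a vertex to its parent. The recursion is therefore a Markov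
  chain running away from the root: given that \<open>J\<close> equals a binary configuration \<open>x\<close> at the
  parent of \<open>v\<close>, the value of \<open>J v\<close> is the single driving variable \<open>I v i\<close> with
  \<open>i = x (pa v)\<close>. So \<open>J = x\<close> on \<open>V\<close> says exactly that \<open>J r = x r\<close> and that one chosen driving
  variable per non-root vertex equals \<open>x v\<close>, and independence gives
  \<open>P(J = x) = P(J r = x r) * (\<Prod>v. P(I v (x (pa v)) = x v))\<close> (\<open>configuration_prob\<close>).

  The bounds in \<open>\<Lambda>(q)\<close> say precisely that all \<open>\<beta>\<close> lie strictly between 0 and 1, so the product is
  positive and has a logarithm. Each factor is a function of the two binary values on one edge (or
  of the value at the root), and any such function is a combination of \<open>1\<close>, \<open>x u\<close>, \<open>x v\<close> and
  \<open>x u * x v\<close>. Adding these up, the logarithm is a constant plus an Ising energy; since the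
  probabilities sum to 1, the constant is minus the log-partition function
  (\<open>ising_form_of_energy_like\<close>).

  The \<open>\<beta>\<close> are chosen so that \<open>(1 - q u) * \<beta>\<^sub>v\<^sub>,\<^sub>0 + q u * \<beta>\<^sub>v\<^sub>,\<^sub>1 = q v\<close> for \<open>u = pa v\<close>, which
  propagates the Bernoulli marginals from the root outwards (\<open>prob_J_and_deeper\<close>), and so that
  \<open>P(J u = 1, J v = 1) = q u * \<beta>\<^sub>v\<^sub>,\<^sub>1\<close> differs from \<open>q u * q v\<close> by the correlation
  \<open>\<alpha>\<close> of the edge times the product of the two standard deviations.
\<close>

section \<open>Parents in a rooted tree\<close>

text \<open>
  The adjacency relation after deletion of \<open>u\<close>. Working with its reflexive transitive closure
  instead of with paths makes concatenation and reversal of connections immediate; paths without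
  repetitions are recovered only where a cycle has to be exhibited.
\<close>

definition avoiding :: "'v set set \<Rightarrow> 'v \<Rightarrow> ('v \<times> 'v) set" where
  "avoiding E u = {(a, b). {a, b} \<in> E \<and> a \<noteq> u \<and> b \<noteq> u}"

lemma sym_avoiding: "sym (avoiding E u)"
  by (auto simp: avoiding_def sym_def insert_commute)

lemma walk_avoiding:
  assumes "successively (\<lambda>a b. {a, b} \<in> E) p" "p \<noteq> []" "u \<notin> set p"
  shows "(hd p, last p) \<in> (avoiding E u)\<^sup>*"
  using assms
proof (induction p rule: induct_list012)
  case (3 x y zs)
  then have "(x, y) \<in> avoiding E u" by (auto simp: avoiding_def)
  with 3 show ?case by (auto intro: converse_rtrancl_into_rtrancl)
qed auto

text \<open>
  A walk contains a path: extending a path by a vertex that it already visits is replaced by cutting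
  the path back at that vertex.
\<close>

lemma avoiding_path:
  assumes "(a, b) \<in> (avoiding E u)\<^sup>*" "a \<in> V" "a \<noteq> u"
    and "\<And>e. e \<in> E \<Longrightarrow> e \<subseteq> V"
  obtains p where "path_between V E a p b" "u \<notin> set p"
proof -
  from assms(1) have "\<exists>p. path_between V E a p b \<and> u \<notin> set p"
  proof (induction rule: rtrancl_induct)
    case base
    show ?case using assms(2,3) by (intro exI[of _ "[a]"]) (auto simp: path_between_def)
  next
    case (step y z)
    then obtain p where p: "path_between V E a p y" "u \<notin> set p" by blast
    have yz: "{y, z} \<in> E" "z \<noteq> u" "z \<in> V"
      using step.hyps assms(4) by (auto simp: avoiding_def)
    show ?case
    proof (cases "z \<in> set p")
      case True
      then obtain p1 p2 where "p = p1 @ z # p2" by (meson split_list)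
      then show ?thesis using p yz
        by (intro exI[of _ "p1 @ [z]"])
          (auto simp: path_between_def successively_append_iff hd_append)
    next
      case False
      then show ?thesis using p yz
        by (intro exI[of _ "p @ [z]"]) (auto simp: path_between_def successively_append_iff)
    qed
  qed
  with that show ?thesis by blast
qed

locale rooted_tree =
  fixes V :: "'v set" and E :: "'v set set" and r :: 'v
  assumes tree: "tree_graph V E" and root: "r \<in> V"
begin

lemma finite_V: "finite V"
  using tree by (simp add: tree_graph_def simple_graph_def)

lemma edge_subset: "e \<in> E \<Longrightarrow> e \<subseteq> V"
  using tree by (fastforce simp: tree_graph_def simple_graph_def)

lemma finite_E: "finite E"
  using edge_subset finite_V by (meson PowI finite_Pow_iff finite_subset subsetI)

lemma edge_distinct: "{u, v} \<in> E \<Longrightarrow> u \<noteq> v"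
  using tree by (fastforce simp: tree_graph_def simple_graph_def)

lemma path_to_root:
  assumes "v \<in> V" obtains p where "path_between V E v p r"
  using tree root assms that unfolding tree_graph_def by blast

lemma dsc_root: "dsc V E r r = V - {r}"
proof -
  have "\<exists>p. path_between V E j p r \<and> r \<in> set p" if "j \<in> V" for j
    using path_to_root[OF that] last_in_set unfolding path_between_def by metis
  then show ?thesis by (auto simp: dsc_def)
qed

text \<open>
  Call a neighbour of \<open>u\<close> that remains connected to \<open>r\<close> after deletion of \<open>u\<close> a root-side
  neighbour. Two different ones would be joined by a path avoiding \<open>u\<close>, and \<open>u\<close> would close it to
  a cycle.
\<close>

lemma unique_root_side_neighbour:
  assumes "{w, u} \<in> E" "{w', u} \<in> E"
    and "(w, r) \<in> (avoiding E u)\<^sup>*" "(w', r) \<in> (avoiding E u)\<^sup>*"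
  shows "w = w'"
proof (rule ccontr)
  assume "w \<noteq> w'"
  have "(r, w') \<in> (avoiding E u)\<^sup>*"
    using assms(4) sym_avoiding by (metis sym_rtrancl symD)
  with assms(3) have "(w, w') \<in> (avoiding E u)\<^sup>*" by (rule rtrancl_trans)
  moreover have "w \<in> V" "w \<noteq> u" using edge_subset edge_distinct assms(1) by blast+
  ultimately obtain p where p: "path_between V E w p w'" "u \<notin> set p"
    using avoiding_path edge_subset by metis
  obtain x y zs where "p = x # y # zs"
    using p(1) \<open>w \<noteq> w'\<close> by (cases p; cases "tl p") (auto simp: path_between_def)
  then have "graph_cycle V E (u # p)"
    using p assms(1,2) edge_subset[OF assms(1)]
    by (auto simp: graph_cycle_def path_between_def insert_commute)
  with tree show False by (auto simp: tree_graph_def)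
qed

text \<open>
  The vertex after \<open>u\<close> on a path to the root is a neighbour of \<open>u\<close> on the root side: the rest of
  the path connects it to \<open>r\<close> without returning to \<open>u\<close>.
\<close>

lemma split_path_at:
  assumes "path_between V E j p r" "u \<in> set p" "u \<noteq> r"
  obtains p1 w p2 where "p = p1 @ u # w # p2" "{w, u} \<in> E"
    "path_between V E w (w # p2) r" "(w, r) \<in> (avoiding E u)\<^sup>*"
proof -
  obtain p1 p2' where p': "p = p1 @ u # p2'" using assms(2) by (meson split_list)
  with assms(1,3) have "p2' \<noteq> []" by (auto simp: path_between_def)
  then obtain w p2 where p: "p = p1 @ u # w # p2" using p' by (cases p2') auto
  have wu: "{w, u} \<in> E" and path: "path_between V E w (w # p2) r" and "u \<notin> set (w # p2)"
    using assms(1) p by (auto simp: path_between_def successively_append_iff insert_commute)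
  then have "(w, r) \<in> (avoiding E u)\<^sup>*"
    using walk_avoiding[of E "w # p2" u] by (auto simp: path_between_def)
  with that p wu path show ?thesis by blast
qed

text \<open>
  A descendant is only required to have some path to the root through \<open>u\<close>. Such a path leaves \<open>u\<close>
  by a root-side neighbour other than \<open>w\<close>, so by uniqueness \<open>w\<close> cannot be on the root side too.
  For neighbours of \<open>u\<close>, being a descendant thus becomes being separated from the root by the
  deletion of \<open>u\<close>.
\<close>

lemma neighbour_in_dsc_iff:
  assumes "{w, u} \<in> E" "u \<noteq> r"
  shows "w \<in> dsc V E r u \<longleftrightarrow> (w, r) \<notin> (avoiding E u)\<^sup>*"
proof -
  have w: "w \<in> V" "w \<noteq> u" using edge_subset edge_distinct assms(1) by blast+
  show ?thesis
  proof
    assume "w \<in> dsc V E r u"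
    then obtain p where p: "path_between V E w p r" "u \<in> set p" by (auto simp: dsc_def)
    obtain p1 z p2 where s: "p = p1 @ u # z # p2" "{z, u} \<in> E" "(z, r) \<in> (avoiding E u)\<^sup>*"
      using split_path_at[OF p assms(2)] by metis
    have "z \<noteq> w" using p(1) s(1) w(2) by (cases p1) (auto simp: path_between_def)
    with unique_root_side_neighbour[OF assms(1) s(2) _ s(3)] show "(w, r) \<notin> (avoiding E u)\<^sup>*"
      by blast
  next
    assume *: "(w, r) \<notin> (avoiding E u)\<^sup>*"
    obtain p where p: "path_between V E w p r" using path_to_root w(1) by blast
    have "u \<in> set p"
      using walk_avoiding[of E p u] p * by (auto simp: path_between_def)
    with p w show "w \<in> dsc V E r u" by (auto simp: dsc_def)
  qed
qed

lemma pa_eqI: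
  assumes "{w, u} \<in> E" "u \<noteq> r" "(w, r) \<in> (avoiding E u)\<^sup>*"
  shows "pa V E r u = w"
  unfolding pa_def
proof (rule the_equality)
  show "{w, u} \<in> E \<and> w \<notin> dsc V E r u" using neighbour_in_dsc_iff assms by blast
next
  fix w' assume "{w', u} \<in> E \<and> w' \<notin> dsc V E r u"
  then show "w' = w" using neighbour_in_dsc_iff unique_root_side_neighbour assms by metis
qed

text \<open>
  The number of vertices on a shortest path to the root; it only serves as a measure that decreases
  from a vertex to its parent.
\<close>

definition depth :: "'v \<Rightarrow> nat" where
  "depth v = (LEAST n. \<exists>p. path_between V E v p r \<and> length p = n)"

text \<open>
  The parent is the second vertex of a shortest path to the root, and the remainder of that path
  bounds the parent's depth.
\<close>

lemma pa_step:
  assumes "v \<in> V" "v \<noteq> r"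
  shows pa_edge: "{pa V E r v, v} \<in> E" and depth_pa: "depth (pa V E r v) < depth v"
proof -
  have "\<exists>n p. path_between V E v p r \<and> length p = n" using path_to_root assms(1) by blast
  then have "\<exists>p. path_between V E v p r \<and> length p = depth v"
    unfolding depth_def by (rule LeastI_ex)
  then obtain p where p: "path_between V E v p r" "length p = depth v" by blast
  then have "v \<in> set p" by (auto simp: path_between_def)
  then obtain p1 w p2 where s: "p = p1 @ v # w # p2" "{w, v} \<in> E"
    "path_between V E w (w # p2) r" "(w, r) \<in> (avoiding E v)\<^sup>*"
    using split_path_at[OF p(1) _ assms(2)] by metis
  have w: "pa V E r v = w" using pa_eqI s assms by blast
  show "{pa V E r v, v} \<in> E" using w s by simp
  have "depth w \<le> length (w # p2)"
    unfolding depth_def using s(3) by (intro Least_le) blast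
  also have "\<dots> < depth v" using p s by auto
  finally show "depth (pa V E r v) < depth v" using w by simp
qed

lemma pa_in_V: "v \<in> V \<Longrightarrow> v \<noteq> r \<Longrightarrow> pa V E r v \<in> V"
  using pa_edge edge_subset by blast

text \<open>
  If \<open>u\<close> is not the parent of \<open>v\<close>, a path from \<open>u\<close> to the root must pass through \<open>v\<close>; its part
  from \<open>v\<close> on avoids \<open>u\<close>, so \<open>v\<close> is the parent of \<open>u\<close>.
\<close>

lemma edge_parent:
  assumes "{u, v} \<in> E"
  shows "(v \<noteq> r \<and> u = pa V E r v) \<or> (u \<noteq> r \<and> v = pa V E r u)"
proof (cases "v = r \<or> (u, r) \<in> (avoiding E v)\<^sup>*")
  case True
  have vu: "{v, u} \<in> E" "u \<noteq> v" using assms edge_distinct by (auto simp: insert_commute)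
  show ?thesis
  proof (cases "v = r")
    case True
    then show ?thesis using pa_eqI[OF vu(1)] vu(2) by auto
  next
    case False
    then show ?thesis using pa_eqI[OF assms] True by auto
  qed
next
  case False
  have u: "u \<in> V" "u \<noteq> v" "{v, u} \<in> E"
    using edge_subset edge_distinct assms by (auto simp: insert_commute)
  obtain p where p: "path_between V E u p r" using path_to_root u(1) by blast
  have "v \<in> set p"
    using walk_avoiding[of E p v] p False by (auto simp: path_between_def)
  then obtain p1 p2 where s: "p = p1 @ v # p2" by (meson split_list)
  have "u \<in> set p1" using p s u(2) by (cases p1) (auto simp: path_between_def)
  then have "u \<notin> set (v # p2)" using p s by (auto simp: path_between_def)
  then have "(v, r) \<in> (avoiding E u)\<^sup>*"
    using walk_avoiding[of E "v # p2" u] p s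
    by (auto simp: path_between_def successively_append_iff)
  moreover have "u \<noteq> r" using p s u \<open>u \<notin> set (v # p2)\<close>
    by (metis last_appendR last_in_set list.discI path_between_def)
  ultimately show ?thesis using pa_eqI[OF u(3)] by auto
qed

end

section \<open>Log-linear functions of binary configurations\<close>

text \<open>
  The functions that agree on binary configurations with an Ising energy up to an additive constant
  form a vector space. Closure under sums spares collecting the coefficients of each vertex over all
  edges at it.
\<close>

definition energy_like :: "'v set \<Rightarrow> 'v set set \<Rightarrow> (('v \<Rightarrow> real) \<Rightarrow> real) \<Rightarrow> bool" where
  "energy_like V E f \<longleftrightarrow>
     (\<exists>c \<eta>v \<eta>e. \<forall>x \<in> V \<rightarrow>\<^sub>E {0, 1}. f x = c + ising_energy V E \<eta>v \<eta>e x)"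

lemma energy_like_cong:
  assumes "energy_like V E f" "\<And>x. x \<in> V \<rightarrow>\<^sub>E {0, 1} \<Longrightarrow> g x = f x"
  shows "energy_like V E g"
  using assms unfolding energy_like_def by metis

lemma energy_like_const: "energy_like V E (\<lambda>x. c)"
  unfolding energy_like_def ising_energy_def
  by (intro exI[of _ c] exI[of _ "\<lambda>_. 0"]) simp

lemma energy_like_vertex:
  assumes "finite V" "u \<in> V"
  shows "energy_like V E (\<lambda>x. c * x u)"
  unfolding energy_like_def ising_energy_def
  by (intro exI[of _ 0] exI[of _ "\<lambda>v. if v = u then c else 0"] exI[of _ "\<lambda>_. 0"])
    (use assms in \<open>simp add: if_distrib[of "\<lambda>a. a * _"] cong: if_cong\<close>)

lemma energy_like_edge:
  assumes "finite E" "{u, v} \<in> E" "u \<noteq> v"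
  shows "energy_like V E (\<lambda>x. c * (x u * x v))"
  unfolding energy_like_def ising_energy_def
  by (intro exI[of _ 0] exI[of _ "\<lambda>_. 0"] exI[of _ "\<lambda>e. if e = {u, v} then c else 0"])
    (use assms in \<open>simp add: if_distrib[of "\<lambda>a. a * _"] cong: if_cong\<close>)

lemma energy_like_add:
  assumes "energy_like V E f" "energy_like V E g"
  shows "energy_like V E (\<lambda>x. f x + g x)"
proof -
  obtain c a b where f: "\<forall>x \<in> V \<rightarrow>\<^sub>E {0, 1}. f x = c + ising_energy V E a b x"
    using assms(1) by (auto simp: energy_like_def)
  obtain c' a' b' where g: "\<forall>x \<in> V \<rightarrow>\<^sub>E {0, 1}. g x = c' + ising_energy V E a' b' x"
    using assms(2) by (auto simp: energy_like_def)
  have "ising_energy V E (\<lambda>v. a v + a' v) (\<lambda>e. b e + b' e) x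
      = ising_energy V E a b x + ising_energy V E a' b' x" for x
    by (simp add: ising_energy_def distrib_right sum.distrib)
  with f g show ?thesis
    unfolding energy_like_def
    by (intro exI[of _ "c + c'"] exI[of _ "\<lambda>v. a v + a' v"] exI[of _ "\<lambda>e. b e + b' e"]) simp
qed

lemma energy_like_sum:
  assumes "finite S" "\<And>s. s \<in> S \<Longrightarrow> energy_like V E (f s)"
  shows "energy_like V E (\<lambda>x. \<Sum>s\<in>S. f s x)"
  using assms by (induction S) (auto intro: energy_like_const energy_like_add)

lemma energy_like_vertex_function:
  assumes "finite V" "u \<in> V"
  shows "energy_like V E (\<lambda>x. g (x u))"
proof (rule energy_like_cong)
  show "energy_like V E (\<lambda>x. g 0 + (g 1 - g 0) * x u)"
    by (intro energy_like_add energy_like_const energy_like_vertex assms)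
  fix x :: "_ \<Rightarrow> real" assume "x \<in> V \<rightarrow>\<^sub>E {0, 1}"
  then have "x u = 0 \<or> x u = 1" using assms(2) by (auto simp: PiE_iff)
  then show "g (x u) = g 0 + (g 1 - g 0) * x u" by auto
qed

text \<open>
  Bilinear interpolation: the four values of a function on \<open>{0, 1} \<times> {0, 1}\<close> are matched by a
  combination of \<open>1\<close>, \<open>s\<close>, \<open>t\<close> and \<open>s * t\<close>.
\<close>

lemma energy_like_edge_function:
  assumes "finite V" "finite E" "{u, v} \<in> E" "u \<noteq> v" "u \<in> V" "v \<in> V"
  shows "energy_like V E (\<lambda>x. g (x u) (x v))"
proof (rule energy_like_cong)
  show "energy_like V E (\<lambda>x. ((g 0 0 + (g 1 0 - g 0 0) * x u) + (g 0 1 - g 0 0) * x v)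
      + (g 1 1 - g 1 0 - g 0 1 + g 0 0) * (x u * x v))"
    by (intro energy_like_add energy_like_const energy_like_vertex energy_like_edge assms)
  fix x :: "_ \<Rightarrow> real" assume "x \<in> V \<rightarrow>\<^sub>E {0, 1}"
  then have "x u = 0 \<or> x u = 1" "x v = 0 \<or> x v = 1" using assms(5,6) by (auto simp: PiE_iff)
  then show "g (x u) (x v) = ((g 0 0 + (g 1 0 - g 0 0) * x u) + (g 0 1 - g 0 0) * x v)
      + (g 1 1 - g 1 0 - g 0 1 + g 0 0) * (x u * x v)" by auto
qed

text \<open>
  Normalisation forces the additive constant to be minus the log-partition function.
\<close>

lemma ising_form_of_energy_like:
  assumes "energy_like V E f" "(\<Sum>x\<in>V \<rightarrow>\<^sub>E {0, 1}. exp (f x)) = 1"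
  shows "\<exists>\<eta>v \<eta>e. \<forall>x \<in> V \<rightarrow>\<^sub>E {0, 1}.
           exp (f x) = exp (ising_energy V E \<eta>v \<eta>e x - log_partition V E \<eta>v \<eta>e)"
proof -
  obtain c a b where f: "\<forall>x \<in> V \<rightarrow>\<^sub>E {0, 1}. f x = c + ising_energy V E a b x"
    using assms(1) by (auto simp: energy_like_def)
  have "1 = exp c * (\<Sum>x\<in>V \<rightarrow>\<^sub>E {0, 1}. exp (ising_energy V E a b x))"
    using assms(2) f by (simp add: exp_add sum_distrib_left)
  then have "(\<Sum>x\<in>V \<rightarrow>\<^sub>E {0, 1}. exp (ising_energy V E a b x)) = exp (- c)"
    by (simp add: exp_minus field_simps)
  then have "log_partition V E a b = - c" by (simp add: log_partition_def)
  with f show ?thesis by (intro exI[of _ a] exI[of _ b]) (simp add: add.commute)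
qed

section \<open>Bernoulli and other binary random variables\<close>

text \<open>
The Bernoulli mass function with parameter \<open>p\<close>, of interest only at \<open>y\<close> in \<open>{0, 1}\<close>.
\<close>

definition bern :: "real \<Rightarrow> real \<Rightarrow> real" where
  "bern p y = (if y = 1 then p else 1 - p)"

context prob_space
begin

lemma bernoulli_rv_prob:
  assumes "bernoulli_rv M p X" "0 \<le> p" "p \<le> 1" "y \<in> {0, 1}"
  shows "prob {\<omega> \<in> space M. X \<omega> = y} = bern p y"
proof -
  have X: "X \<in> borel_measurable M"
    and d: "distr M borel X = distr (bernoulli_pmf p) borel of_bool"
    using assms(1) by (auto simp: bernoulli_rv_def)
  have "prob {\<omega> \<in> space M. X \<omega> = y} = measure (distr M borel X) {y}"
    using X by (subst measure_distr) (auto intro!: arg_cong[where f = prob])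
  also have "\<dots> = measure (bernoulli_pmf p) (of_bool -` {y})"
    unfolding d by (subst measure_distr) auto
  also have "of_bool -` {y} = {y = 1}" using assms(4) by auto
  finally show ?thesis using assms(2,3) by (auto simp: bern_def measure_pmf_single)
qed

lemma bernoulli_rv_AE:
  assumes "bernoulli_rv M p X"
  shows "AE \<omega> in M. X \<omega> \<in> {0, 1}"
proof -
  have X: "X \<in> borel_measurable M"
    and d: "distr M borel X = distr (bernoulli_pmf p) borel of_bool"
    using assms by (auto simp: bernoulli_rv_def)
  have "AE y in distr (bernoulli_pmf p) borel of_bool. y \<in> {0, 1::real}"
    by (subst AE_distr_iff) auto
  then have "AE y in distr M borel X. y \<in> {0, 1}" by (simp only: d)
  then show ?thesis using X by (subst (asm) AE_distr_iff) auto
qed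

lemma binary_expectation:
  assumes "X \<in> borel_measurable M" "AE \<omega> in M. X \<omega> \<in> {0, 1}"
  shows "expectation X = prob {\<omega> \<in> space M. X \<omega> = 1}"
proof -
  have "expectation X = expectation (indicator {\<omega> \<in> space M. X \<omega> = 1})"
    using assms by (intro integral_cong_AE) (auto simp: indicator_def)
  then show ?thesis using assms(1) by simp
qed

lemma binary_integrable:
  assumes "X \<in> borel_measurable M" "AE \<omega> in M. X \<omega> \<in> {0, 1::real}"
  shows "integrable M X"
  using assms by (intro integrable_const_bound[where B = 1]) auto

lemma binary_variance:
  assumes "X \<in> borel_measurable M" "AE \<omega> in M. X \<omega> \<in> {0, 1::real}"
  shows "variance X = expectation X * (1 - expectation X)"
proof -
  have sq: "AE \<omega> in M. (X \<omega>)\<^sup>2 = X \<omega>" using assms(2) by auto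
  have "integrable M (\<lambda>\<omega>. (X \<omega>)\<^sup>2)"
    using assms by (intro binary_integrable) auto
  then have "variance X = expectation (\<lambda>\<omega>. (X \<omega>)\<^sup>2) - (expectation X)\<^sup>2"
    using binary_integrable[OF assms] by (intro variance_eq)
  also have "expectation (\<lambda>\<omega>. (X \<omega>)\<^sup>2) = expectation X"
    using assms(1) sq by (intro integral_cong_AE) auto
  finally show ?thesis by (simp add: power2_eq_square algebra_simps)
qed

text \<open>
  The product of binary variables is the indicator of both being 1, so the covariance needs only
  that one joint probability.
\<close>

lemma binary_correlation:
  assumes X: "X \<in> borel_measurable M" "AE \<omega> in M. X \<omega> \<in> {0, 1::real}"
    and Y: "Y \<in> borel_measurable M" "AE \<omega> in M. Y \<omega> \<in> {0, 1::real}"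
  shows "correlation M X Y
    = (prob {\<omega> \<in> space M. X \<omega> = 1 \<and> Y \<omega> = 1} - expectation X * expectation Y)
      / sqrt ((expectation X * (1 - expectation X)) * (expectation Y * (1 - expectation Y)))"
proof -
  have XY: "(\<lambda>\<omega>. X \<omega> * Y \<omega>) \<in> borel_measurable M" "AE \<omega> in M. X \<omega> * Y \<omega> \<in> {0, 1}"
    using X Y by auto
  have [simp]: "integrable M X" "integrable M Y" "integrable M (\<lambda>\<omega>. X \<omega> * Y \<omega>)"
    using X Y XY by (auto intro: binary_integrable)
  have "expectation (\<lambda>\<omega>. (X \<omega> - expectation X) * (Y \<omega> - expectation Y))
      = expectation (\<lambda>\<omega>. X \<omega> * Y \<omega> - expectation Y * X \<omega> - expectation X * Y \<omega>
          + expectation X * expectation Y)"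
    by (simp add: algebra_simps)
  also have "\<dots> = expectation (\<lambda>\<omega>. X \<omega> * Y \<omega>) - expectation X * expectation Y"
    by (simp add: prob_space)
  also have "expectation (\<lambda>\<omega>. X \<omega> * Y \<omega>) = prob {\<omega> \<in> space M. X \<omega> * Y \<omega> = 1}"
    by (rule binary_expectation[OF XY])
  also have "\<dots> = prob {\<omega> \<in> space M. X \<omega> = 1 \<and> Y \<omega> = 1}"
    using X Y XY by (intro finite_measure_eq_AE) auto
  finally show ?thesis
    by (simp add: correlation_def binary_variance[OF X] binary_variance[OF Y])
qed

end

section \<open>Binary Markov chains along parent pointers\<close>

lemma driving_family_simps:
  "driving_family X I None = X" "driving_family X I (Some (v, i)) = I v i"
  by (simp_all add: driving_family_def)

text \<open>
  The second index of the driving variable that a parent value \<open>a \<in> {0, 1}\<close> selects: \<open>a\<close> itself,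
  as a natural number.
\<close>

definition selector :: "real \<Rightarrow> nat" where "selector a = (if a = 1 then 1 else 0)"

text \<open>
  The probabilistic content of the construction, without the graph: a parent function along which a
  natural-valued \<open>depth\<close> decreases, and selection probabilities for which the prescribed marginals
  are consistent along each parent-child pair (\<open>mix\<close>).
\<close>

locale tree_markov_chain = prob_space M for M :: "'w measure" +
  fixes V :: "'v set" and r :: 'v and par :: "'v \<Rightarrow> 'v" and depth :: "'v \<Rightarrow> nat"
    and q :: "'v \<Rightarrow> real" and \<beta> :: "'v \<Rightarrow> nat \<Rightarrow> real"
    and J :: "'v \<Rightarrow> 'w \<Rightarrow> real" and I :: "'v \<Rightarrow> nat \<Rightarrow> 'w \<Rightarrow> real"
  assumes finite_V: "finite V" and root: "r \<in> V"
    and par: "\<And>v. v \<in> V \<Longrightarrow> v \<noteq> r \<Longrightarrow> par v \<in> V \<and> depth (par v) < depth v"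
    and q: "\<And>v. v \<in> V \<Longrightarrow> 0 < q v \<and> q v < 1"
    and \<beta>: "\<And>v i. v \<in> V \<Longrightarrow> v \<noteq> r \<Longrightarrow> i \<in> {0, 1} \<Longrightarrow> 0 < \<beta> v i \<and> \<beta> v i < 1"
    and mix: "\<And>v. v \<in> V \<Longrightarrow> v \<noteq> r \<Longrightarrow>
          (1 - q (par v)) * \<beta> v 0 + q (par v) * \<beta> v 1 = q v"
    and J_root: "bernoulli_rv M (q r) (J r)"
    and I_bernoulli: "\<And>v i. v \<in> V \<Longrightarrow> v \<noteq> r \<Longrightarrow> i \<in> {0, 1} \<Longrightarrow> bernoulli_rv M (\<beta> v i) (I v i)"
    and indep: "indep_vars (\<lambda>_. borel) (driving_family (J r) I)
          (insert None (Some ` ((V - {r}) \<times> {0, 1})))"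
    and J_step: "\<And>v \<omega>. v \<in> V \<Longrightarrow> v \<noteq> r \<Longrightarrow> \<omega> \<in> space M \<Longrightarrow>
          J v \<omega> = (1 - J (par v) \<omega>) * I v 0 \<omega> + J (par v) \<omega> * I v 1 \<omega>"
begin

abbreviation "D \<equiv> driving_family (J r) I"

abbreviation "indices \<equiv> insert None (Some ` ((V - {r}) \<times> {0, 1 :: nat}))"

definition success :: "('v \<times> nat) option \<Rightarrow> real" where
  "success k = (case k of None \<Rightarrow> q r | Some (v, i) \<Rightarrow> \<beta> v i)"

lemma parent_induct [consumes 1, case_names root step]:
  assumes "v \<in> V" "P r" "\<And>v. v \<in> V \<Longrightarrow> v \<noteq> r \<Longrightarrow> P (par v) \<Longrightarrow> P v"
  shows "P v"
  using assms(1)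
proof (induction v rule: measure_induct_rule[where f = depth])
  case (less v)
  then show ?case using assms(2,3) par by metis
qed

lemma driving_bernoulli:
  assumes "k \<in> indices"
  shows "bernoulli_rv M (success k) (D k)" "0 < success k" "success k < 1"
proof -
  have "bernoulli_rv M (success k) (D k) \<and> 0 < success k \<and> success k < 1"
  proof (cases k)
    case None
    then show ?thesis using J_root q[OF root] by (simp add: success_def driving_family_simps)
  next
    case (Some z)
    with assms obtain v i where k: "k = Some (v, i)" "v \<in> V" "v \<noteq> r" "i \<in> {0, 1}" by blast
    show ?thesis using I_bernoulli[OF k(2-)] \<beta>[OF k(2-)]
      by (simp add: k(1) success_def driving_family_simps)
  qed
  then show "bernoulli_rv M (success k) (D k)" "0 < success k" "success k < 1" by auto
qed

lemma driving_event:
  assumes "K \<subseteq> indices"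
  shows "{\<omega> \<in> space M. \<forall>k\<in>K. D k \<omega> = y k} \<in> events"
proof -
  have [measurable]: "D k \<in> borel_measurable M" if "k \<in> K" for k
    using driving_bernoulli(1)[of k] assms that unfolding bernoulli_rv_def by blast
  have "finite K" using assms finite_V by (auto intro: finite_subset)
  then show ?thesis by measurable
qed

lemma driving_prob:
  assumes "K \<subseteq> indices" "\<And>k. k \<in> K \<Longrightarrow> y k \<in> {0, 1}"
  shows "prob {\<omega> \<in> space M. \<forall>k\<in>K. D k \<omega> = y k} = (\<Prod>k\<in>K. bern (success k) (y k))"
proof (cases "K = {}")
  case True
  then show ?thesis by (simp add: prob_space)
next
  case False
  have "finite K" using assms finite_V by (auto intro: finite_subset)
  have "{\<omega> \<in> space M. \<forall>k\<in>K. D k \<omega> = y k} = (\<Inter>k\<in>K. D k -` {y k} \<inter> space M)"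
    using False by auto
  also have "prob \<dots> = (\<Prod>k\<in>K. prob (D k -` {y k} \<inter> space M))"
    using indep_varsD[OF indep False \<open>finite K\<close> assms(1)] by auto
  also have "\<dots> = (\<Prod>k\<in>K. bern (success k) (y k))"
  proof (rule prod.cong[OF refl])
    fix k assume k: "k \<in> K"
    have "D k -` {y k} \<inter> space M = {\<omega> \<in> space M. D k \<omega> = y k}" by auto
    then show "prob (D k -` {y k} \<inter> space M) = bern (success k) (y k)"
      using bernoulli_rv_prob driving_bernoulli[of k] assms k by (simp add: less_imp_le subset_iff)
  qed
  finally show ?thesis .
qed

lemma J_measurable [measurable]: "v \<in> V \<Longrightarrow> J v \<in> borel_measurable M"
proof (induction v rule: parent_induct)
  case root
  show ?case using J_root by (simp add: bernoulli_rv_def)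
next
  case (step v)
  have [measurable]: "I v 0 \<in> borel_measurable M" "I v 1 \<in> borel_measurable M"
    using I_bernoulli step.hyps by (auto simp: bernoulli_rv_def)
  note [measurable] = step.IH
  have "(\<lambda>\<omega>. (1 - J (par v) \<omega>) * I v 0 \<omega> + J (par v) \<omega> * I v 1 \<omega>) \<in> borel_measurable M"
    by measurable
  then show ?case using J_step step.hyps by (subst measurable_cong) auto
qed

lemma J_selects:
  assumes "v \<in> V" "v \<noteq> r" "\<omega> \<in> space M" "J (par v) \<omega> \<in> {0, 1}"
  shows "J v \<omega> = I v (selector (J (par v) \<omega>)) \<omega>"
  using assms J_step by (auto simp: selector_def)

lemma J_binary: "AE \<omega> in M. \<forall>v\<in>V. J v \<omega> \<in> {0, 1}"
proof -
  have "finite indices" using finite_V by simp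
  then have "AE \<omega> in M. \<forall>k\<in>indices. D k \<omega> \<in> {0, 1}"
    using bernoulli_rv_AE driving_bernoulli(1) by (intro AE_finite_allI) blast+
  then show ?thesis
  proof (rule AE_mp, intro AE_I2 impI ballI)
    fix \<omega> v assume \<omega>: "\<omega> \<in> space M" "\<forall>k\<in>indices. D k \<omega> \<in> {0, 1}" and "v \<in> V"
    from \<open>v \<in> V\<close> show "J v \<omega> \<in> {0, 1}"
    proof (induction v rule: parent_induct)
      case root
      show ?case using \<omega>(2) by (simp add: driving_family_simps)
    next
      case (step v)
      have "D (Some (v, i)) \<omega> \<in> {0, 1}" if "i \<in> {0, 1}" for i
        using \<omega>(2) step.hyps that by blast
      then show ?case using J_selects[OF step.hyps \<omega>(1) step.IH]
        by (auto simp: selector_def driving_family_simps)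
    qed
  qed
qed

text \<open>
  The event is rewritten in terms of one driving variable per vertex. From left to right, \<open>J\<close> at the
  parent is known to be binary and selects the variable; from right to left, the values of \<open>J\<close> are
  recovered by induction from the root outwards.
\<close>

lemma configuration_prob:
  assumes x: "x \<in> V \<rightarrow>\<^sub>E {0, 1}"
  shows "prob {\<omega> \<in> space M. \<forall>v\<in>V. J v \<omega> = x v}
    = bern (q r) (x r) * (\<Prod>v\<in>V - {r}. bern (\<beta> v (selector (x (par v)))) (x v))"
proof -
  define s where "s v = Some (v, selector (x (par v)))" for v
  define y where "y k = (case k of None \<Rightarrow> x r | Some (v, i :: nat) \<Rightarrow> x v)" for k
  define K where "K = insert None (s ` (V - {r}))"
  have xb: "x v \<in> {0, 1}" if "v \<in> V" for v using x that by (auto simp: PiE_iff)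
  have eq: "(\<forall>v\<in>V. J v \<omega> = x v) \<longleftrightarrow> (\<forall>k\<in>K. D k \<omega> = y k)" if \<omega>: "\<omega> \<in> space M" for \<omega>
  proof
    assume J: "\<forall>v\<in>V. J v \<omega> = x v"
    have "I v (selector (x (par v))) \<omega> = x v" if v: "v \<in> V" "v \<noteq> r" for v
    proof -
      have "J (par v) \<omega> = x (par v)" using J par v by blast
      with J_selects[OF v \<omega>] xb[of "par v"] par[OF v] J v show ?thesis by simp
    qed
    then show "\<forall>k\<in>K. D k \<omega> = y k"
      using J root by (auto simp: K_def s_def y_def driving_family_simps)
  next
    assume *: "\<forall>k\<in>K. D k \<omega> = y k"
    show "\<forall>v\<in>V. J v \<omega> = x v"
    proof
      fix v assume "v \<in> V"
      then show "J v \<omega> = x v"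
      proof (induction v rule: parent_induct)
        case root
        show ?case using * by (simp add: K_def y_def driving_family_simps)
      next
        case (step v)
        have "s v \<in> K" using step.hyps by (simp add: K_def)
        with * have "D (s v) \<omega> = y (s v)" by blast
        then show ?case using J_selects[OF step.hyps \<omega>] step xb par
          by (simp add: s_def y_def driving_family_simps)
      qed
    qed
  qed
  have "selector a \<in> {0, 1}" for a by (simp add: selector_def)
  then have K: "K \<subseteq> indices" unfolding K_def s_def by blast
  have yb: "y k \<in> {0, 1}" if "k \<in> K" for k
  proof -
    have "y k \<in> x ` V" using that root by (auto simp: K_def y_def s_def)
    then obtain v where "v \<in> V" "y k = x v" by blast
    then show ?thesis using xb[of v] by simp
  qed
  have "{\<omega> \<in> space M. \<forall>v\<in>V. J v \<omega> = x v} = {\<omega> \<in> space M. \<forall>k\<in>K. D k \<omega> = y k}"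
    using eq by blast
  then have "prob {\<omega> \<in> space M. \<forall>v\<in>V. J v \<omega> = x v} = (\<Prod>k\<in>K. bern (success k) (y k))"
    using driving_prob[OF K yb] by simp
  also have "\<dots> = bern (q r) (x r) * (\<Prod>k\<in>s ` (V - {r}). bern (success k) (y k))"
    unfolding K_def using finite_V by (subst prod.insert) (auto simp: s_def success_def y_def)
  also have "(\<Prod>k\<in>s ` (V - {r}). bern (success k) (y k))
      = (\<Prod>v\<in>V - {r}. bern (\<beta> v (selector (x (par v)))) (x v))"
    by (subst prod.reindex) (auto simp: inj_on_def s_def success_def y_def)
  finally show ?thesis .
qed

lemma configuration_prob_total:
  "(\<Sum>x\<in>V \<rightarrow>\<^sub>E {0, 1}. prob {\<omega> \<in> space M. \<forall>v\<in>V. J v \<omega> = x v}) = 1"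
proof -
  let ?C = "\<lambda>x. {\<omega> \<in> space M. \<forall>v\<in>V. J v \<omega> = x v}"
  have ev: "?C x \<in> events" for x
    using finite_V J_measurable by measurable
  have "disjoint_family_on ?C (V \<rightarrow>\<^sub>E {0, 1})"
    unfolding disjoint_family_on_def
  proof (intro ballI impI)
    fix x x' :: "'v \<Rightarrow> real" assume *: "x \<in> V \<rightarrow>\<^sub>E {0, 1}" "x' \<in> V \<rightarrow>\<^sub>E {0, 1}" "x \<noteq> x'"
    then obtain v where "v \<in> V" "x v \<noteq> x' v" by (meson PiE_ext)
    then show "?C x \<inter> ?C x' = {}" by force
  qed
  then have "(\<Sum>x\<in>V \<rightarrow>\<^sub>E {0, 1}. prob (?C x)) = prob (\<Union>x\<in>V \<rightarrow>\<^sub>E {0, 1}. ?C x)"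
    using finite_V ev by (intro finite_measure_finite_Union[symmetric]) (auto intro!: finite_PiE)
  also have "\<dots> = 1"
  proof (rule prob_eq_1[THEN iffD2])
    show "(\<Union>x\<in>V \<rightarrow>\<^sub>E {0, 1}. ?C x) \<in> events"
      using finite_V ev by (intro sets.finite_UN) (auto intro!: finite_PiE)
    show "AE \<omega> in M. \<omega> \<in> (\<Union>x\<in>V \<rightarrow>\<^sub>E {0, 1}. ?C x)"
      using J_binary
    proof (rule AE_mp, intro AE_I2 impI)
      fix \<omega> assume "\<omega> \<in> space M" "\<forall>v\<in>V. J v \<omega> \<in> {0, 1}"
      then show "\<omega> \<in> (\<Union>x\<in>V \<rightarrow>\<^sub>E {0, 1}. ?C x)"
        by (intro UN_I[of "restrict (\<lambda>v. J v \<omega>) V"]) auto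
    qed
  qed
  finally show ?thesis .
qed

text \<open>
  \<open>J u\<close> is built from driving variables at depth at most that of \<open>u\<close>, hence is independent of those
  attached to deeper vertices. Stating the marginal of \<open>J u\<close> jointly with an arbitrary event about
  deeper variables lets both facts be proved in one induction: splitting on the value of the parent
  turns \<open>J u = a\<close> into a condition on one driving variable at \<open>u\<close>, which is itself deeper than the
  parent and so joins the event of the induction hypothesis.
\<close>

lemma prob_J_and_deeper:
  assumes "u \<in> V" "a \<in> {0, 1}" "K \<subseteq> Some ` ({w \<in> V - {r}. depth u < depth w} \<times> {0, 1})"
    "\<And>k. k \<in> K \<Longrightarrow> y k \<in> {0, 1}"
  shows "prob {\<omega> \<in> space M. J u \<omega> = a \<and> (\<forall>k\<in>K. D k \<omega> = y k)}
    = bern (q u) a * (\<Prod>k\<in>K. bern (success k) (y k))"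
  using assms
proof (induction u arbitrary: a K y rule: parent_induct)
  case root
  have K: "insert None K \<subseteq> indices" "finite K" "None \<notin> K"
    using root(2) finite_V by (auto intro: finite_subset)
  define y' where "y' = y(None := a)"
  have y': "y' None = a" "\<And>k. k \<in> K \<Longrightarrow> y' k = y k" using K(3) by (auto simp: y'_def)
  have "{\<omega> \<in> space M. J r \<omega> = a \<and> (\<forall>k\<in>K. D k \<omega> = y k)}
      = {\<omega> \<in> space M. \<forall>k\<in>insert None K. D k \<omega> = y' k}"
    by (auto simp: y' driving_family_simps)
  also have "prob \<dots> = (\<Prod>k\<in>insert None K. bern (success k) (y' k))"
    using root(1,3) y' by (intro driving_prob K) (metis insertE)
  also have "\<dots> = bern (q r) a * (\<Prod>k\<in>K. bern (success k) (y' k))"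
    using K by (simp add: y' success_def)
  also have "(\<Prod>k\<in>K. bern (success k) (y' k)) = (\<Prod>k\<in>K. bern (success k) (y k))"
    by (intro prod.cong) (auto simp: y')
  finally show ?case .
next
  case (step u)
  note u = step.hyps and a = step.prems(1) and KK = step.prems(2) and y = step.prems(3)
  define B where "B b = {\<omega> \<in> space M. J (par u) \<omega> = b \<and> (I u (selector b) \<omega> = a
      \<and> (\<forall>k\<in>K. D k \<omega> = y k))}" for b
  have Ki: "K \<subseteq> indices" "finite K" using KK finite_V by (auto intro: finite_subset)
  have [measurable]: "I u i \<in> borel_measurable M" if "i \<in> {0, 1}" for i
    using I_bernoulli[OF u that] by (simp add: bernoulli_rv_def)
  have [measurable]: "J u \<in> borel_measurable M" "J (par u) \<in> borel_measurable M"
    using u par J_measurable by auto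
  have [measurable]: "{\<omega> \<in> space M. \<forall>k\<in>K. D k \<omega> = y k} \<in> events"
    by (rule driving_event[OF Ki(1)])
  have [measurable]: "I u (selector b) \<in> borel_measurable M" for b
    by (auto simp: selector_def)
  have ev: "B b \<in> events" for b unfolding B_def by measurable
  have PB: "prob (B b) = bern (q (par u)) b * (bern (\<beta> u (selector b)) a
      * (\<Prod>k\<in>K. bern (success k) (y k)))" if b: "b \<in> {0, 1}" for b
  proof -
    let ?k = "Some (u, selector b)"
    have k: "?k \<notin> K" using KK by auto
    define y' where "y' = y(?k := a)"
    have y': "y' ?k = a" "\<And>k. k \<in> K \<Longrightarrow> y' k = y k" using k by (auto simp: y'_def)
    have "B b = {\<omega> \<in> space M. J (par u) \<omega> = b \<and> (\<forall>k\<in>insert ?k K. D k \<omega> = y' k)}"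
      by (auto simp: B_def y' driving_family_simps)
    also have "prob \<dots> = bern (q (par u)) b * (\<Prod>k\<in>insert ?k K. bern (success k) (y' k))"
    proof (rule step.IH[OF b])
      have "(u, selector b) \<in> {w \<in> V - {r}. depth (par u) < depth w} \<times> {0, 1}"
        using par[OF u] u by (simp add: selector_def)
      moreover have "{w \<in> V - {r}. depth u < depth w} \<subseteq> {w \<in> V - {r}. depth (par u) < depth w}"
        using par[OF u] by auto
      ultimately show "insert ?k K \<subseteq> Some ` ({w \<in> V - {r}. depth (par u) < depth w} \<times> {0, 1})"
        using KK by blast
      show "y' k \<in> {0, 1}" if "k \<in> insert ?k K" for k using that y a y' by (metis insertE)
    qed
    also have "(\<Prod>k\<in>insert ?k K. bern (success k) (y' k))
        = bern (\<beta> u (selector b)) a * (\<Prod>k\<in>K. bern (success k) (y' k))"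
      using k Ki by (simp add: y' success_def)
    also have "(\<Prod>k\<in>K. bern (success k) (y' k)) = (\<Prod>k\<in>K. bern (success k) (y k))"
      by (intro prod.cong) (auto simp: y')
    finally show ?thesis .
  qed
  \<comment> \<open>Only almost surely: off a null set the parent takes one of the two values.\<close>
  have "prob {\<omega> \<in> space M. J u \<omega> = a \<and> (\<forall>k\<in>K. D k \<omega> = y k)} = prob (B 0 \<union> B 1)"
  proof (rule finite_measure_eq_AE)
    show "AE \<omega> in M. \<omega> \<in> {\<omega> \<in> space M. J u \<omega> = a \<and> (\<forall>k\<in>K. D k \<omega> = y k)} \<longleftrightarrow> \<omega> \<in> B 0 \<union> B 1"
      using J_binary
    proof (rule AE_mp, intro AE_I2 impI)
      fix \<omega> assume \<omega>: "\<omega> \<in> space M" "\<forall>v\<in>V. J v \<omega> \<in> {0, 1}"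
      then have "J (par u) \<omega> \<in> {0, 1}" using par u by blast
      with J_selects[OF u \<omega>(1)] \<omega>(1)
      show "\<omega> \<in> {\<omega> \<in> space M. J u \<omega> = a \<and> (\<forall>k\<in>K. D k \<omega> = y k)} \<longleftrightarrow> \<omega> \<in> B 0 \<union> B 1"
        by (auto simp: B_def)
    qed
  qed (use ev in measurable)
  also have "\<dots> = prob (B 0) + prob (B 1)"
    using ev by (intro finite_measure_Union) (auto simp: B_def)
  also have "\<dots> = ((1 - q (par u)) * bern (\<beta> u 0) a + q (par u) * bern (\<beta> u 1) a)
      * (\<Prod>k\<in>K. bern (success k) (y k))"
    by (simp add: PB bern_def selector_def algebra_simps)
  also have "(1 - q (par u)) * bern (\<beta> u 0) a + q (par u) * bern (\<beta> u 1) a = bern (q u) a"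
    using mix[OF u] by (auto simp: bern_def algebra_simps)
  finally show ?case .
qed

lemma J_expectation:
  assumes "v \<in> V"
  shows "expectation (J v) = q v"
proof -
  have "AE \<omega> in M. J v \<omega> \<in> {0, 1}" using J_binary by (rule AE_mp) (use assms in auto)
  then show ?thesis
    using prob_J_and_deeper[of v 1 "{}"] assms
    by (simp add: binary_expectation bern_def)
qed

text \<open>
  When the parent is 1 the recursion reads \<open>J v = I v 1\<close>, and \<open>I v 1\<close> is deeper than the parent.
\<close>

lemma J_parent_and_child:
  assumes v: "v \<in> V" "v \<noteq> r"
  shows "prob {\<omega> \<in> space M. J (par v) \<omega> = 1 \<and> J v \<omega> = 1} = q (par v) * \<beta> v 1"
proof -
  have "{\<omega> \<in> space M. J (par v) \<omega> = 1 \<and> J v \<omega> = 1}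
      = {\<omega> \<in> space M. J (par v) \<omega> = 1 \<and> (\<forall>k\<in>{Some (v, 1)}. D k \<omega> = 1)}"
    using J_step[OF v] by (auto simp: driving_family_simps)
  also have "prob \<dots> = q (par v) * \<beta> v 1"
    using prob_J_and_deeper[of "par v" 1 "{Some (v, 1)}" "\<lambda>_. 1"] par[OF v] v
    by (simp add: bern_def success_def)
  finally show ?thesis .
qed

lemma J_correlation:
  assumes v: "v \<in> V" "v \<noteq> r"
  shows "correlation M (J (par v)) (J v)
    = (q (par v) * \<beta> v 1 - q (par v) * q v)
      / sqrt ((q (par v) * (1 - q (par v))) * (q v * (1 - q v)))"
proof -
  have AE: "AE \<omega> in M. J w \<omega> \<in> {0, 1}" if "w \<in> V" for w
    using J_binary by (rule AE_mp) (use that in auto)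
  have "par v \<in> V" using par v by blast
  then show ?thesis
    using binary_correlation[of "J (par v)" "J v"] AE v J_expectation J_parent_and_child by simp
qed

text \<open>
  The logarithm of the product formula is a sum of functions each living on a single edge or on the
  root, hence an Ising energy up to a constant; strict positivity of all factors is what makes the
  logarithm available.
\<close>

lemma J_ising_form:
  assumes "finite E" "\<And>v. v \<in> V \<Longrightarrow> v \<noteq> r \<Longrightarrow> {par v, v} \<in> E"
  shows "\<exists>\<eta>v \<eta>e. \<forall>x \<in> V \<rightarrow>\<^sub>E {0, 1}. prob {\<omega> \<in> space M. \<forall>v\<in>V. J v \<omega> = x v}
    = exp (ising_energy V E \<eta>v \<eta>e x - log_partition V E \<eta>v \<eta>e)"
proof -
  define f where "f x = ln (bern (q r) (x r))
      + (\<Sum>v\<in>V - {r}. ln (bern (\<beta> v (selector (x (par v)))) (x v)))" for x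
  have "energy_like V E f"
    unfolding f_def
  proof (intro energy_like_add energy_like_sum)
    show "energy_like V E (\<lambda>x. ln (bern (q r) (x r)))"
      using energy_like_vertex_function[OF finite_V root, of E "\<lambda>t. ln (bern (q r) t)"] .
    show "finite (V - {r})" using finite_V by simp
    fix v assume "v \<in> V - {r}"
    then have "v \<in> V" "v \<noteq> r" "par v \<in> V" "par v \<noteq> v" using par[of v] by auto
    then show "energy_like V E (\<lambda>x. ln (bern (\<beta> v (selector (x (par v)))) (x v)))"
      using energy_like_edge_function[of V E "par v" v "\<lambda>s t. ln (bern (\<beta> v (selector s)) t)"]
        assms finite_V by simp
  qed
  moreover have eq: "prob {\<omega> \<in> space M. \<forall>v\<in>V. J v \<omega> = x v} = exp (f x)"
    if "x \<in> V \<rightarrow>\<^sub>E {0, 1}" for x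
  proof -
    have "0 < bern (q r) (x r)" using q[OF root] by (simp add: bern_def)
    moreover have "0 < bern (\<beta> v (selector (x (par v)))) (x v)" if "v \<in> V - {r}" for v
      using \<beta>[of v "selector (x (par v))"] that by (auto simp: bern_def selector_def)
    ultimately show ?thesis
      using configuration_prob[OF that] finite_V by (simp add: f_def exp_add exp_sum)
  qed
  moreover have "(\<Sum>x\<in>V \<rightarrow>\<^sub>E {0, 1}. exp (f x)) = 1"
    using configuration_prob_total eq by simp
  ultimately show ?thesis using ising_form_of_energy_like[of V E f] by simp
qed

end

section \<open>The tree-structured Ising model\<close>

text \<open>
  The form in which the bounds of \<open>\<Lambda>(q)\<close> are used: with \<open>s = \<sigma>\<close>, the number \<open>s\<^sup>2\<close> is the product
  of \<open>q u\<close>, \<open>q v\<close>, \<open>1 - q u\<close>, \<open>1 - q v\<close>, and each of the four bounds is \<open>sqrt (m / n)\<close> for one way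
  of splitting these factors into \<open>m\<close> and \<open>n\<close>.
\<close>

lemma mult_lt_sqrt_bound:
  fixes a s m n :: real
  assumes "0 < s" "0 < m" "0 < n" "s\<^sup>2 = m * n" "a < sqrt (m / n)"
  shows "a * s < m"
proof -
  have "a * s < sqrt (m / n) * s" using assms(1,5) by simp
  also have "\<dots> = sqrt (m / n * s\<^sup>2)" unfolding real_sqrt_mult using assms(1) by simp
  also have "m / n * s\<^sup>2 = m\<^sup>2"
    unfolding assms(4) using assms(3) by (simp add: power2_eq_square)
  also have "sqrt (m\<^sup>2) = m" using assms(2) by simp
  finally show ?thesis .
qed

text \<open>
  Clearing denominators, each of the four inequalities is one of the four bounds of \<open>\<Lambda>(q)\<close>.
\<close>

lemma
  fixes V E r q \<alpha> v
  defines "u \<equiv> pa V E r v"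
  assumes \<alpha>: "\<alpha> \<in> Lambda E q" and e: "{u, v} \<in> E"
    and u: "0 < q u" "q u < 1" and v: "0 < q v" "q v < 1"
  shows beta0_bounds: "0 < beta0 V E r q \<alpha> v" "beta0 V E r q \<alpha> v < 1"
    and beta1_bounds: "0 < beta1 V E r q \<alpha> v" "beta1 V E r q \<alpha> v < 1"
proof -
  define s where "s = edge_sigma q u v"
  have s: "0 < s" "s\<^sup>2 = q u * q v * (1 - q u) * (1 - q v)"
    using u v by (auto simp: s_def edge_sigma_def)
  have b0: "beta0 V E r q \<alpha> v = q v - \<alpha> {u, v} * (s / (1 - q u))"
    and b1: "beta1 V E r q \<alpha> v = q v + \<alpha> {u, v} * (s / q u)"
    by (simp_all add: beta0_def beta1_def u_def s_def Let_def)
  have bounds: "- \<alpha> {u, v} < sqrt (q u * q v / ((1 - q u) * (1 - q v)))"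
    "- \<alpha> {u, v} < sqrt ((1 - q u) * (1 - q v) / (q u * q v))"
    "\<alpha> {u, v} < sqrt ((1 - q u) * q v / (q u * (1 - q v)))"
    "\<alpha> {u, v} < sqrt (q u * (1 - q v) / ((1 - q u) * q v))"
  proof -
    have "- min (sqrt (q u * q v / ((1 - q u) * (1 - q v))))
           (sqrt ((1 - q u) * (1 - q v) / (q u * q v))) < \<alpha> {u, v} \<and>
        \<alpha> {u, v} < min (sqrt ((1 - q u) * q v / (q u * (1 - q v))))
           (sqrt (q u * (1 - q v) / ((1 - q u) * q v)))"
      using \<alpha> e unfolding Lambda_def by blast
    then show "- \<alpha> {u, v} < sqrt (q u * q v / ((1 - q u) * (1 - q v)))"
      "- \<alpha> {u, v} < sqrt ((1 - q u) * (1 - q v) / (q u * q v))"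
      "\<alpha> {u, v} < sqrt ((1 - q u) * q v / (q u * (1 - q v)))"
      "\<alpha> {u, v} < sqrt (q u * (1 - q v) / ((1 - q u) * q v))" by linarith+
  qed
  have "- \<alpha> {u, v} * s < q u * q v"
    by (rule mult_lt_sqrt_bound[OF s(1) _ _ _ bounds(1)]; use u v in \<open>simp add: s(2)\<close>)
  moreover have "- \<alpha> {u, v} * s < (1 - q u) * (1 - q v)"
    by (rule mult_lt_sqrt_bound[OF s(1) _ _ _ bounds(2)]; use u v in \<open>simp add: s(2)\<close>)
  moreover have "\<alpha> {u, v} * s < (1 - q u) * q v"
    by (rule mult_lt_sqrt_bound[OF s(1) _ _ _ bounds(3)]; use u v in \<open>simp add: s(2)\<close>)
  moreover have "\<alpha> {u, v} * s < q u * (1 - q v)"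
    by (rule mult_lt_sqrt_bound[OF s(1) _ _ _ bounds(4)]; use u v in \<open>simp add: s(2)\<close>)
  ultimately show "0 < beta0 V E r q \<alpha> v" "beta0 V E r q \<alpha> v < 1"
    "0 < beta1 V E r q \<alpha> v" "beta1 V E r q \<alpha> v < 1"
    using u unfolding b0 b1 by (simp_all add: field_simps)
qed

theorem theorem2:
  fixes d r :: nat
    and V :: "nat set" and E :: "nat set set"
    and q :: "nat \<Rightarrow> real" and \<alpha> :: "nat set \<Rightarrow> real"
    and M :: "'w measure"
    and J :: "nat \<Rightarrow> 'w \<Rightarrow> real" and I :: "nat \<Rightarrow> nat \<Rightarrow> 'w \<Rightarrow> real"
  assumes "V = {1..d}"
    and "tree_graph V E"
    and "r \<in> V"
    and "\<forall>v\<in>V. 0 < q v \<and> q v < 1"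
    and "\<alpha> \<in> Lambda E q"
    and "prob_space M"
    and "bernoulli_rv M (q r) (J r)"
    and "\<forall>v \<in> dsc V E r r. bernoulli_rv M (beta0 V E r q \<alpha> v) (I v 0)"
    and "\<forall>v \<in> dsc V E r r. bernoulli_rv M (beta1 V E r q \<alpha> v) (I v 1)"
    and "prob_space.indep_vars M (\<lambda>_. borel) (driving_family (J r) I)
           (insert None (Some ` (dsc V E r r \<times> {0, 1})))"
    and "\<forall>v \<in> dsc V E r r. \<forall>\<omega> \<in> space M.
           J v \<omega> = (1 - J (pa V E r v) \<omega>) * I v 0 \<omega> + J (pa V E r v) \<omega> * I v 1 \<omega>"
  shows "tree_ising_model V E q \<alpha> M J"
proof -
  interpret T: rooted_tree V E r using assms(2,3) by unfold_locales
  note dsc = T.dsc_root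
  define \<beta> where "\<beta> v i = (if i = (0::nat) then beta0 V E r q \<alpha> v else beta1 V E r q \<alpha> v)" for v i
  have q: "0 < q v \<and> q v < 1" if "v \<in> V" for v using assms(4) that by blast
  have \<beta>: "0 < \<beta> v i \<and> \<beta> v i < 1" if "v \<in> V" "v \<noteq> r" for v i
    using beta0_bounds[OF assms(5) T.pa_edge[OF that]] beta1_bounds[OF assms(5) T.pa_edge[OF that]]
      q[OF T.pa_in_V[OF that]] q[OF that(1)] by (simp add: \<beta>_def)
  interpret prob_space M by fact
  interpret C: tree_markov_chain M V r "pa V E r" T.depth q \<beta> J I
  proof unfold_locales
    show "finite V" by (rule T.finite_V)
    show "r \<in> V" by fact
    fix v assume v: "v \<in> V" "v \<noteq> r"
    show "pa V E r v \<in> V \<and> T.depth (pa V E r v) < T.depth v"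
      using T.pa_in_V T.depth_pa v by blast
    show "(1 - q (pa V E r v)) * \<beta> v 0 + q (pa V E r v) * \<beta> v 1 = q v"
      using q[OF T.pa_in_V[OF v]]
      by (simp add: \<beta>_def beta0_def beta1_def Let_def field_simps)
    show "bernoulli_rv M (\<beta> v i) (I v i)" if "i \<in> {0, 1}" for i
      using assms(8,9) v that by (auto simp: \<beta>_def dsc)
    show "0 < \<beta> v i \<and> \<beta> v i < 1" for i using \<beta> v by blast
    show "J v \<omega> = (1 - J (pa V E r v) \<omega>) * I v 0 \<omega> + J (pa V E r v) \<omega> * I v 1 \<omega>"
      if "\<omega> \<in> space M" for \<omega> using assms(11) v that by (simp add: dsc)
  qed (use q assms(7,10) in \<open>auto simp: dsc\<close>)
  have corr: "correlation M (J (pa V E r v)) (J v) = \<alpha> {pa V E r v, v}" if v: "v \<in> V" "v \<noteq> r" for v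
  proof -
    define u where "u = pa V E r v"
    have u: "0 < q u" "q u < 1" using q[OF T.pa_in_V[OF v]] by (auto simp: u_def)
    have s: "edge_sigma q u v = sqrt ((q u * (1 - q u)) * (q v * (1 - q v)))"
      by (simp add: edge_sigma_def ac_simps)
    have "edge_sigma q u v > 0" using u q[OF v(1)] by (simp add: edge_sigma_def)
    moreover have "q u * \<beta> v 1 - q u * q v = \<alpha> {u, v} * edge_sigma q u v"
      using u by (simp add: \<beta>_def beta1_def Let_def u_def field_simps)
    ultimately show ?thesis
      using C.J_correlation[OF v] unfolding u_def[symmetric] s[symmetric] by simp
  qed
  have corr_sym: "correlation M X Y = correlation M Y X" for X Y
    by (simp add: correlation_def mult.commute)
  show ?thesis
    unfolding tree_ising_model_def
  proof (intro conjI allI impI ballI)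
    show "AE \<omega> in M. \<forall>v\<in>V. J v \<omega> \<in> {0, 1}" by (rule C.J_binary)
    show "\<exists>\<eta>v \<eta>e. \<forall>x \<in> V \<rightarrow>\<^sub>E {0, 1}. prob {\<omega> \<in> space M. \<forall>v\<in>V. J v \<omega> = x v}
        = exp (ising_energy V E \<eta>v \<eta>e x - log_partition V E \<eta>v \<eta>e)"
      by (rule C.J_ising_form[OF T.finite_E T.pa_edge])
    show "J v \<in> borel_measurable M" if "v \<in> V" for v by (rule C.J_measurable[OF that])
    show "expectation (J v) = q v" if "v \<in> V" for v by (rule C.J_expectation[OF that])
    fix u v assume e: "{u, v} \<in> E"
    then have "u \<in> V" "v \<in> V" using T.edge_subset by blast+
    then show "correlation M (J u) (J v) = \<alpha> {u, v}"
      using T.edge_parent[OF e] corr corr_sym by (metis insert_commute)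
  qed
qed

end
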